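(* For every positive integer $k$, the path $P_{4k+1}$ is not determined by its Hermitian spectrum (not DHS).
   Context: A mixed graph has undirected edges and directed edges (ordered pairs $(x,y)$). For vertices $v_1,\dots,v_n$, its Hermitian adjacency matrix $H(X)$ has $(j,k)$ entry $1$ if $v_jv_k$ is an undirected edge, $i$ if $(v_j,v_k)$ is a directed edge, $-i$ if $(v_k,v_j)$ is a directed edge, $0$ otherwise; $\mathrm{Spec}_H(X)$ is its multiset of eigenvalues. Mixed graphs $X,Y$ on the same vertex set are switching equivalent if $H(X)=D^{-1}H(Y)D$ for a diagonal $D$ with diagonal entries in $\{\pm1,\pm i\}$. A mixed graph $X$ is DHS if every mixed graph $Y$ with $\mathrm{Spec}_H(Y)=\mathrm{Spec}_H(X)$ is switching equivalent to a mixed graph isomorphic to $X$. $P_n$ is the path on $n$ vertices with all edges undirected. *)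

theory Defs
  imports "Jordan_Normal_Form.Char_Poly"
begin

record 'a mixed_graph =
  verts :: "'a set"
  edges :: "'a set set"
  arcs :: "('a \<times> 'a) set"

text \<open>Mixed graphs are finite and simple: no loops, and two vertices are joined by at most
  one undirected edge or one directed edge, so the cases in the Hermitian adjacency matrix
  are mutually exclusive.\<close>

definition mixed_graph :: "'a mixed_graph \<Rightarrow> bool" where
  "mixed_graph X \<longleftrightarrow>
     finite (verts X) \<and>
     (\<forall>e \<in> edges X. e \<subseteq> verts X \<and> card e = 2) \<and>
     (\<forall>(x, y) \<in> arcs X. x \<in> verts X \<and> y \<in> verts X \<and> x \<noteq> y \<and>
        (y, x) \<notin> arcs X \<and> {x, y} \<notin> edges X)"

definition hermitian_entry :: "'a mixed_graph \<Rightarrow> 'a \<Rightarrow> 'a \<Rightarrow> complex" where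
  "hermitian_entry X x y =
     (if {x, y} \<in> edges X then 1
      else if (x, y) \<in> arcs X then \<i>
      else if (y, x) \<in> arcs X then - \<i>
      else 0)"

text \<open>The enumeration \<open>v\<^sub>1, \<dots>, v\<^sub>n\<close> of the vertices is the increasing one. Any other
  enumeration conjugates the matrix by a permutation matrix.\<close>

definition hermitian_adj_mat :: "'a::linorder mixed_graph \<Rightarrow> complex mat" where
  "hermitian_adj_mat X =
     (let n = card (verts X); v = sorted_list_of_set (verts X)
      in mat n n (\<lambda>(j, k). hermitian_entry X (v ! j) (v ! k)))"

text \<open>Eigenvalues are counted with algebraic multiplicity, which for a Hermitian matrix is
  the geometric one.\<close>

definition hermitian_spec :: "'a::linorder mixed_graph \<Rightarrow> complex multiset" where
  "hermitian_spec X = proots (char_poly (hermitian_adj_mat X))"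

definition switching_equivalent :: "'a::linorder mixed_graph \<Rightarrow> 'a mixed_graph \<Rightarrow> bool" where
  "switching_equivalent X Y \<longleftrightarrow>
     verts X = verts Y \<and>
     (let n = card (verts X) in
      \<exists>D D'. D \<in> carrier_mat n n \<and> D' \<in> carrier_mat n n \<and>
        diagonal_mat D \<and> (\<forall>j<n. D $$ (j, j) \<in> {1, -1, \<i>, -\<i>}) \<and>
        inverts_mat D D' \<and> inverts_mat D' D \<and>
        hermitian_adj_mat X = D' * hermitian_adj_mat Y * D)"

definition mixed_graph_iso :: "'a mixed_graph \<Rightarrow> 'b mixed_graph \<Rightarrow> bool" where
  "mixed_graph_iso X Y \<longleftrightarrow>
     (\<exists>f. bij_betw f (verts X) (verts Y) \<and>
          edges Y = (\<lambda>e. f ` e) ` edges X \<and>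
          arcs Y = map_prod f f ` arcs X)"

text \<open>\<open>Y\<close> ranges over the mixed graphs with vertices in the same type as \<open>X\<close>. This loses
  nothing: equal spectra force equally many vertices, so every mixed graph cospectral with
  \<open>X\<close> has an isomorphic copy on the vertex set of \<open>X\<close>.\<close>

definition DHS :: "'a::linorder mixed_graph \<Rightarrow> bool" where
  "DHS X \<longleftrightarrow>
     (\<forall>Y :: 'a mixed_graph. mixed_graph Y \<and> hermitian_spec Y = hermitian_spec X \<longrightarrow>
        (\<exists>Z. mixed_graph Z \<and> mixed_graph_iso Z X \<and> switching_equivalent Y Z))"

definition path_graph :: "nat \<Rightarrow> nat mixed_graph" where
  "path_graph n = \<lparr>verts = {0..<n}, edges = {{i, Suc i} | i. Suc i < n}, arcs = {}\<rparr>"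

lemma mixed_graph_path_graph: "mixed_graph (path_graph n)"
  by (auto simp: mixed_graph_def path_graph_def)

end

theory Submission
  imports Defs
begin

text \<open>For \<open>n \<ge> 3\<close> the path on \<open>2n - 1\<close> vertices is cospectral with the disjoint union of the path
  on \<open>n - 1\<close> vertices and an \<open>n\<close>-cycle with exactly one directed edge. To see this, unfold
  vectors to sequences on \<open>\<int>\<close> on which the adjacency operator acts by
  \<open>(A u) j = u (j - 1) + u (j + 1)\<close>. The path corresponds to sequences odd about \<open>0\<close> and
  about \<open>2n\<close>, and the cycle to sequences with \<open>u (j + n) = \<i> * u j\<close>. Folding
  \<open>u\<close> to \<open>u j - u (-j)\<close> maps the cycle isomorphically onto the vectors of the path symmetric
  about its midpoint, and the shorter path is the antisymmetric part. The two graphs are not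
  switching equivalent up to isomorphism, because switching keeps the underlying graph and a path
  contains no cycle.\<close>

section \<open>Sparse matrices and intertwiners; the graphs and the folding map in row form\<close>

text \<open>Each row is a list of column-value pairs. Values at a repeated column add up, so
  coinciding indices in \<open>fold_rows\<close> need no separate case.\<close>

definition sparse_mat :: "nat \<Rightarrow> (nat \<Rightarrow> (nat \<times> 'a::comm_ring_1) list) \<Rightarrow> 'a mat" where
  "sparse_mat N f = mat N N (\<lambda>(a, c). \<Sum>(p, x)\<leftarrow>f a. if c = p then x else 0)"

lemma sparse_mat_carrier [simp]: "sparse_mat N f \<in> carrier_mat N N"
  by (simp add: sparse_mat_def)

lemma sparse_mat_dim [simp]: "dim_row (sparse_mat N f) = N" "dim_col (sparse_mat N f) = N"
  by (simp_all add: sparse_mat_def)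

lemma sparse_mat_mult_vec:
  assumes "a < N" and "v \<in> carrier_vec N" and "\<forall>(p, x) \<in> set (f a). p < N"
  shows "(sparse_mat N f *\<^sub>v v) $ a = (\<Sum>(p, x)\<leftarrow>f a. x * v $ p)"
proof -
  have "(\<Sum>c = 0..<N. (\<Sum>(p, x)\<leftarrow>ps. if c = p then x else 0) * v $ c) = (\<Sum>(p, x)\<leftarrow>ps. x * v $ p)"
    if "\<forall>(p, x) \<in> set ps. p < N" for ps
    using that
  proof (induction ps)
    case (Cons q ps)
    obtain p x where q: "q = (p, x)" by fastforce
    have "(\<Sum>c = 0..<N. (if c = p then x else 0) * v $ c) = x * v $ p"
      using Cons.prems q by (simp add: if_distrib[of "\<lambda>z. z * _"] sum.delta cong: if_cong)
    then show ?case
      using Cons q by (simp add: distrib_right sum.distrib)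
  qed simp
  from this[OF assms(3)] show ?thesis
    using assms(1,2) by (simp add: sparse_mat_def scalar_prod_def)
qed

lemma eq_mat_mult_vecI:
  fixes A B :: "'a::comm_ring_1 mat"
  assumes "A \<in> carrier_mat m n" "B \<in> carrier_mat m n"
    and eq: "\<And>v. v \<in> carrier_vec n \<Longrightarrow> A *\<^sub>v v = B *\<^sub>v v"
  shows "A = B"
proof (rule eq_matI)
  fix i j assume ij: "i < dim_row B" "j < dim_col B"
  have entry: "C $$ (i, j) = (C *\<^sub>v unit_vec n j) $ i" if "C \<in> carrier_mat m n" for C :: "'a mat"
    using that ij assms(2) by simp
  show "A $$ (i, j) = B $$ (i, j)"
    unfolding entry[OF assms(1)] entry[OF assms(2)] by (simp add: eq)
qed (use assms in auto)

text \<open>An injective square matrix over a field has nonzero determinant, so \<open>T\<close> can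
  be inverted in \<open>A * T = T * B\<close>.\<close>

lemma similar_mat_intertwine:
  fixes A B T :: "'a::field mat"
  assumes A: "A \<in> carrier_mat n n" and B: "B \<in> carrier_mat n n" and T: "T \<in> carrier_mat n n"
    and AT: "A * T = T * B"
    and inj: "\<And>v. v \<in> carrier_vec n \<Longrightarrow> T *\<^sub>v v = 0\<^sub>v n \<Longrightarrow> v = 0\<^sub>v n"
  shows "similar_mat A B"
proof -
  have "det T \<noteq> 0"
    using det_0_iff_vec_prod_zero_field[OF T] inj by auto
  from det_non_zero_imp_unit[OF T this, of "()"] obtain S
    where S: "S \<in> carrier_mat n n" "S * T = 1\<^sub>m n" "T * S = 1\<^sub>m n"
    unfolding Units_def ring_mat_simps by auto
  have "A = A * (T * S)"
    using A S by simp
  also have "\<dots> = T * B * S"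
    using assoc_mult_mat[OF A T S(1)] by (simp add: AT)
  finally show ?thesis
    using A B T S by (intro similar_matI[of _ _ T S n]) auto
qed

text \<open>The cycle occupies the vertices \<open>n - 1, \<dots>, 2n - 2\<close>.\<close>

definition path_cycle_graph :: "nat \<Rightarrow> nat mixed_graph" where
  "path_cycle_graph n =
    \<lparr>verts = {0..<2 * n - 1},
     edges = {{i, Suc i} | i. Suc i < 2 * n - 1 \<and> i \<noteq> n - 2},
     arcs = {(2 * n - 2, n - 1)}\<rparr>"

lemma mixed_graph_path_cycle_graph:
  assumes "n \<ge> 3"
  shows "mixed_graph (path_cycle_graph n)"
  using assms by (auto simp: mixed_graph_def path_cycle_graph_def doubleton_eq_iff)

definition path_rows :: "nat \<Rightarrow> nat \<Rightarrow> (nat \<times> complex) list" where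
  "path_rows N a =
    (if a = 0 then [] else [(a - 1, 1)]) @ (if Suc a < N then [(Suc a, 1)] else [])"

text \<open>The factors at the seam of the cycle are \<open>u (-1) = - \<i> * u (n - 1)\<close> and
  \<open>u n = \<i> * u 0\<close>.\<close>

definition path_cycle_rows :: "nat \<Rightarrow> nat \<Rightarrow> (nat \<times> complex) list" where
  "path_cycle_rows n a =
    (if a = 0 then [] else if a = n - 1 then [(2 * n - 2, - \<i>)] else [(a - 1, 1)]) @
    (if a = n - 2 then [] else if a = 2 * n - 2 then [(n - 1, \<i>)] else [(Suc a, 1)])"

text \<open>With the path vertices numbered \<open>j = a + 1\<close>, with cycle coordinates \<open>u 0, \<dots>, u (n - 1)\<close> at
  the indices from \<open>n - 1\<close> on, and with coordinates \<open>p 1, \<dots>, p (n - 1)\<close> of the shorter path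
  at the indices up to \<open>n - 2\<close>, row \<open>j < n\<close> is \<open>u j - u (-j) + p j\<close> where
  \<open>u (-j) = - \<i> * u (n - j)\<close>, and the rows \<open>j > n\<close> are the reflected ones, with
  \<open>p\<close> negated.\<close>

definition fold_rows :: "nat \<Rightarrow> nat \<Rightarrow> (nat \<times> complex) list" where
  "fold_rows n a =
    (if a < n - 1 then [(a, 1), (n + a, 1), (2 * n - 2 - a, \<i>)]
     else if a = n - 1 then [(n - 1, 2 * \<i>)]
     else [(2 * n - 2 - a, - 1), (3 * n - 2 - a, 1), (a, \<i>)])"

section \<open>Adjacency matrices of the two graphs\<close>

lemma hermitian_adj_mat_initial_segment:
  assumes "verts X = {0..<N}"
  shows "hermitian_adj_mat X = mat N N (\<lambda>(j, k). hermitian_entry X j k)"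
  using assms by (intro eq_matI) (auto simp: hermitian_adj_mat_def Let_def)

lemma path_entry:
  "hermitian_entry (path_graph N) j k =
    (if (k = Suc j \<or> j = Suc k) \<and> max j k < N then 1 else 0)"
proof -
  have "{j, k} \<in> edges (path_graph N) \<longleftrightarrow> (k = Suc j \<or> j = Suc k) \<and> max j k < N"
    by (auto simp: path_graph_def doubleton_eq_iff)
  then show ?thesis
    by (simp add: hermitian_entry_def path_graph_def)
qed

lemma path_cycle_entry:
  assumes "n \<ge> 3"
  shows "hermitian_entry (path_cycle_graph n) j k =
    (if k = Suc j \<and> k < 2 * n - 1 \<and> j \<noteq> n - 2 \<or> j = Suc k \<and> j < 2 * n - 1 \<and> k \<noteq> n - 2 then 1
     else if j = 2 * n - 2 \<and> k = n - 1 then \<i>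
     else if j = n - 1 \<and> k = 2 * n - 2 then - \<i>
     else 0)"
proof -
  let ?E = "edges (path_cycle_graph n)"
  have E: "?E = {{i, Suc i} | i. Suc i < 2 * n - 1 \<and> i \<noteq> n - 2}"
    by (simp add: path_cycle_graph_def)
  have edge: "{i, Suc i} \<in> ?E" if "Suc i < 2 * n - 1" "i \<noteq> n - 2" for i
    unfolding E using that by blast
  have "{j, k} \<in> ?E \<longleftrightarrow>
      k = Suc j \<and> k < 2 * n - 1 \<and> j \<noteq> n - 2 \<or> j = Suc k \<and> j < 2 * n - 1 \<and> k \<noteq> n - 2"
    (is "_ \<longleftrightarrow> ?R")
  proof
    assume "{j, k} \<in> ?E"
    then obtain i where "{j, k} = {i, Suc i}" "Suc i < 2 * n - 1" "i \<noteq> n - 2"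
      unfolding E by blast
    then show ?R
      unfolding doubleton_eq_iff by (elim disjE) simp_all
  next
    assume ?R
    then show "{j, k} \<in> ?E"
      using edge[of j] edge[of k] by (metis insert_commute)
  qed
  moreover have "arcs (path_cycle_graph n) = {(2 * n - 2, n - 1)}"
    by (simp add: path_cycle_graph_def)
  ultimately show ?thesis
    unfolding hermitian_entry_def by (simp only: singleton_iff prod.inject) argo
qed

lemma path_adj_mat: "hermitian_adj_mat (path_graph N) = sparse_mat N (path_rows N)"
proof -
  have "verts (path_graph N) = {0..<N}"
    by (simp add: path_graph_def)
  then show ?thesis
    unfolding hermitian_adj_mat_initial_segment[OF \<open>verts _ = _\<close>] sparse_mat_def
    by (intro cong_mat) (auto simp: path_entry path_rows_def)
qed

lemma path_cycle_adj_mat: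
  assumes "n \<ge> 3"
  shows "hermitian_adj_mat (path_cycle_graph n) = sparse_mat (2 * n - 1) (path_cycle_rows n)"
proof -
  have "verts (path_cycle_graph n) = {0..<2 * n - 1}"
    by (simp add: path_cycle_graph_def)
  moreover have "hermitian_entry (path_cycle_graph n) j k =
      (\<Sum>(p, x)\<leftarrow>path_cycle_rows n j. if k = p then x else 0)"
    if jk: "j < 2 * n - 1" "k < 2 * n - 1" for j k
  proof -
    \<comment> \<open>This removes truncated subtraction. The special rows are the two ends of the
      short path and the two ends of the cycle segment.\<close>
    obtain m where n: "n = m + 3"
      using assms by (metis add.commute le_Suc_ex)
    consider "j = 0" | "j = m + 1" | "j = m + 2" | "j = 2 * m + 4"
      | "0 < j" "j \<noteq> m + 1" "j \<noteq> m + 2" "j < 2 * m + 4"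
      using jk n by linarith
    then show ?thesis
    proof cases
      case 5
      then obtain i where "j = Suc i" by (cases j) auto
      with 5 show ?thesis
        using jk n by (auto simp: path_cycle_entry path_cycle_rows_def)
    qed (use jk n in \<open>auto simp: path_cycle_entry path_cycle_rows_def\<close>)
  qed
  ultimately show ?thesis
    by (auto simp: hermitian_adj_mat_initial_segment sparse_mat_def intro!: cong_mat)
qed

section \<open>Folding and cospectrality\<close>

lemma path_mult_vec:
  assumes "a < N" "v \<in> carrier_vec N"
  shows "(sparse_mat N (path_rows N) *\<^sub>v v) $ a =
    (if a = 0 then 0 else v $ (a - 1)) + (if Suc a < N then v $ Suc a else 0)"
  using assms by (subst sparse_mat_mult_vec) (auto simp: path_rows_def)

lemma path_cycle_mult_vec:
  assumes "n \<ge> 3" "a < 2 * n - 1" "v \<in> carrier_vec (2 * n - 1)"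
  shows "(sparse_mat (2 * n - 1) (path_cycle_rows n) *\<^sub>v v) $ a =
    (if a = 0 then 0 else if a = n - 1 then - \<i> * v $ (2 * n - 2) else v $ (a - 1)) +
    (if a = n - 2 then 0 else if a = 2 * n - 2 then \<i> * v $ (n - 1) else v $ Suc a)"
proof -
  obtain m where m: "n = m + 3"
    using assms(1) by (metis add.commute le_Suc_ex)
  have "\<forall>(p, x) \<in> set (path_cycle_rows n a). p < 2 * n - 1"
    using assms(2) by (auto simp: path_cycle_rows_def m)
  from sparse_mat_mult_vec[where f = "path_cycle_rows n", OF assms(2,3) this] show ?thesis
    by (simp add: path_cycle_rows_def del: index_mult_mat_vec)
qed

lemma fold_mult_vec:
  assumes "n \<ge> 3" "a < 2 * n - 1" "v \<in> carrier_vec (2 * n - 1)"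
  shows "(sparse_mat (2 * n - 1) (fold_rows n) *\<^sub>v v) $ a =
    (if a < n - 1 then v $ a + v $ (n + a) + \<i> * v $ (2 * n - 2 - a)
     else if a = n - 1 then 2 * \<i> * v $ (n - 1)
     else - v $ (2 * n - 2 - a) + v $ (3 * n - 2 - a) + \<i> * v $ a)"
  using assms by (subst sparse_mat_mult_vec) (auto simp: fold_rows_def)

text \<open>On unfolded sequences both operators take the sum of the two neighbours, which commutes
  with reflection and hence with folding.\<close>

lemma fold_intertwines:
  assumes n: "n \<ge> 3"
  defines "N \<equiv> 2 * n - 1"
  shows "sparse_mat N (path_rows N) * sparse_mat N (fold_rows n) =
    sparse_mat N (fold_rows n) * sparse_mat N (path_cycle_rows n)" (is "?P * ?T = ?T * ?Y")
proof (rule eq_mat_mult_vecI[of _ N N])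
  fix v :: "complex vec" assume v: "v \<in> carrier_vec N"
  define w y where "w = ?T *\<^sub>v v" and "y = ?Y *\<^sub>v v"
  have wy: "w \<in> carrier_vec N" "y \<in> carrier_vec N"
    using v by (auto simp: w_def y_def mult_mat_vec_def)
  note w = fold_mult_vec[OF n _ v[unfolded N_def], folded N_def, folded w_def]
  note y = path_cycle_mult_vec[OF n _ v[unfolded N_def], folded N_def, folded y_def]
  obtain m where m: "n = m + 3"
    using n by (metis add.commute le_Suc_ex)
  have N: "N = 2 * m + 5"
    by (simp add: N_def m)
  have "?P *\<^sub>v w = ?T *\<^sub>v y"
  proof (rule eq_vecI)
    fix a assume "a < dim_vec (?T *\<^sub>v y)"
    then have a: "a < N" by simp
    \<comment> \<open>Boundary cases are the two path ends and the midpoint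
      \<open>m + 2 = n - 1\<close> with its neighbours; inside each half the formulas are
      uniform.\<close>
    consider "a = 0" | i where "a = Suc i" "i < m" | "a = m + 1" | "a = m + 2" | "a = m + 3"
      | i where "a = m + 4 + i" "i < m" | "a = 2 * m + 4"
    proof -
      have "a = 0 \<or> (\<exists>i<m. a = Suc i) \<or> a = m + 1 \<or> a = m + 2 \<or> a = m + 3 \<or>
          (\<exists>i<m. a = m + 4 + i) \<or> a = 2 * m + 4"
        using a N by presburger
      then show thesis using that by blast
    qed
    then have "(if a = 0 then 0 else w $ (a - 1)) + (if Suc a < N then w $ Suc a else 0) =
      (if a < n - 1 then y $ a + y $ (n + a) + \<i> * y $ (2 * n - 2 - a)
       else if a = n - 1 then 2 * \<i> * y $ (n - 1)
       else - y $ (2 * n - 2 - a) + y $ (3 * n - 2 - a) + \<i> * y $ a)"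
    proof cases
      case (2 i)
      \<comment> \<open>With this form of \<open>m\<close>, truncated differences such as
        \<open>2 * n - 2 - a\<close> become sums.\<close>
      then obtain d where "m = Suc (i + d)"
        using less_imp_Suc_add by blast
      with 2 show ?thesis
        by (simp add: w y N m algebra_simps)
    next
      case (6 i)
      then obtain d where "m = Suc (i + d)"
        using less_imp_Suc_add by blast
      with 6 show ?thesis
        by (simp add: w y N m algebra_simps)
    qed (simp_all add: w y N m algebra_simps, simp add: numeral_3_eq_3)
    then show "(?P *\<^sub>v w) $ a = (?T *\<^sub>v y) $ a"
      using path_mult_vec[OF a wy(1)] fold_mult_vec[OF n a[unfolded N_def] wy(2)[unfolded N_def]]
      unfolding N_def[symmetric] by simp
  qed simp
  then show "(?P * ?T) *\<^sub>v v = (?T * ?Y) *\<^sub>v v"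
    using v by (simp add: assoc_mult_mat_vec[of _ N N _ N] w_def y_def)
qed auto

text \<open>Mirror rows differ only in the sign of the short-path coordinate, so subtracting them
  kills it. What remains couples \<open>u j\<close> and \<open>u (n - j)\<close>.\<close>

lemma fold_injective:
  assumes n: "n \<ge> 3" and v: "v \<in> carrier_vec (2 * n - 1)"
    and Tv: "sparse_mat (2 * n - 1) (fold_rows n) *\<^sub>v v = 0\<^sub>v (2 * n - 1)"
  shows "v = 0\<^sub>v (2 * n - 1)"
proof -
  note row = fold_mult_vec[OF n _ v, unfolded Tv]
  have mid: "v $ (n - 1) = 0"
    using row[of "n - 1"] n by simp
  have sum: "v $ a + v $ (n + a) + \<i> * v $ (2 * n - 2 - a) = 0" if "a < n - 1" for a
    using row[of a] that by simp
  have diff: "- v $ a + v $ (n + a) + \<i> * v $ (2 * n - 2 - a) = 0" if "a < n - 1" for a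
  proof -
    have b: "2 * n - 2 - a < 2 * n - 1" "\<not> 2 * n - 2 - a < n - 1" "2 * n - 2 - a \<noteq> n - 1"
      "2 * n - 2 - (2 * n - 2 - a) = a" "3 * n - 2 - (2 * n - 2 - a) = n + a"
      using that by auto
    show ?thesis
      using row[OF b(1)] unfolding b(4,5) index_zero_vec(1)[OF b(1)] if_not_P[OF b(2)] if_not_P[OF b(3)]
      by (rule sym)
  qed
  have low: "v $ a = 0" if "a < n - 1" for a
    using sum[OF that] diff[OF that] by (simp add: algebra_simps add_eq_0_iff)
  have high: "v $ (n + a) = 0" if a: "a < n - 1" for a
  proof -
    \<comment> \<open>For \<open>j = a + 1\<close>, row \<open>n - 2 - a\<close> belongs to
      \<open>n - j\<close> and involves the same two cycle coordinates, swapped.\<close>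
    have b: "n - 2 - a < n - 1" "n + (n - 2 - a) = 2 * n - 2 - a" "2 * n - 2 - (n - 2 - a) = n + a"
      using a by auto
    have "v $ (n + a) + \<i> * v $ (2 * n - 2 - a) = 0"
      using sum[OF a] low[OF a] by simp
    moreover have "v $ (2 * n - 2 - a) + \<i> * v $ (n + a) = 0"
      using sum[OF b(1)] low[OF b(1)] b by simp
    \<comment> \<open>Since \<open>\<i> * \<i> = -1\<close>, the two terms add up to twice the
      coordinate instead of cancelling.\<close>
    ultimately have "v $ (n + a) + \<i> * (- (\<i> * v $ (n + a))) = 0"
      by (simp add: add_eq_0_iff)
    then show ?thesis by simp
  qed
  show ?thesis
  proof (rule eq_vecI)
    fix a assume "a < dim_vec (0\<^sub>v (2 * n - 1) :: complex vec)"
    then have a: "a < 2 * n - 1" by simp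
    consider "a < n - 1" | "a = n - 1" | "n \<le> a" by linarith
    then show "v $ a = 0\<^sub>v (2 * n - 1) $ a"
      using a low mid high[of "a - n"] by cases auto
  qed (use v in auto)
qed

lemma path_cycle_cospectral:
  assumes "n \<ge> 3"
  shows "hermitian_spec (path_cycle_graph n) = hermitian_spec (path_graph (2 * n - 1))"
proof -
  have "similar_mat (hermitian_adj_mat (path_graph (2 * n - 1)))
      (hermitian_adj_mat (path_cycle_graph n))"
    unfolding path_adj_mat path_cycle_adj_mat[OF assms]
    by (rule similar_mat_intertwine[OF _ _ _ fold_intertwines[OF assms] fold_injective[OF assms]])
      auto
  from char_poly_similar[OF this] show ?thesis
    by (simp add: hermitian_spec_def)
qed

section \<open>Switching preserves the underlying graph\<close>

text \<open>Comparing entries in \<open>D * A = B * D\<close> gives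
  \<open>D j j * A j k = B j k * D k k\<close>, and \<open>D j j\<close> is nonzero.\<close>

lemma switching_equivalent_entry_nonzero:
  fixes X Y :: "nat mixed_graph"
  assumes "switching_equivalent X Y" "verts X = {0..<n}" "j < n" "k < n"
    and nz: "hermitian_entry X j k \<noteq> 0"
  shows "hermitian_entry Y j k \<noteq> 0"
proof -
  let ?A = "hermitian_adj_mat X" and ?B = "hermitian_adj_mat Y"
  have Y: "verts Y = {0..<n}"
    using assms by (simp add: switching_equivalent_def)
  have A: "?A \<in> carrier_mat n n" and B: "?B \<in> carrier_mat n n"
    using assms(2) Y by (auto simp: hermitian_adj_mat_initial_segment)
  obtain D D' where D: "D \<in> carrier_mat n n" "D' \<in> carrier_mat n n" "diagonal_mat D"
    "\<forall>j<n. D $$ (j, j) \<in> {1, -1, \<i>, -\<i>}" "inverts_mat D D'" "?A = D' * ?B * D"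
    using assms(1,2) by (auto simp: switching_equivalent_def Let_def)
  have "D * ?A = (D * D') * (?B * D)"
    using D(1,2) B by (simp add: D(6) assoc_mult_mat[of _ n n _ n _ n])
  also have "\<dots> = ?B * D"
    using D(1,2,5) B by (simp add: inverts_mat_def)
  finally have DA: "(D * ?A) $$ (j, k) = (?B * D) $$ (j, k)" by simp
  have "(D * ?A) $$ (j, k) = (\<Sum>c = 0..<n. D $$ (j, c) * ?A $$ (c, k))"
    using A D(1) assms by (simp add: scalar_prod_def)
  also have "\<dots> = (\<Sum>c = 0..<n. if c = j then D $$ (j, j) * ?A $$ (j, k) else 0)"
    using D(1,3) assms by (intro sum.cong) (auto simp: diagonal_mat_def)
  finally have L: "(D * ?A) $$ (j, k) = D $$ (j, j) * ?A $$ (j, k)"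
    using assms by simp
  have "(?B * D) $$ (j, k) = (\<Sum>c = 0..<n. ?B $$ (j, c) * D $$ (c, k))"
    using B D(1) assms by (simp add: scalar_prod_def)
  also have "\<dots> = (\<Sum>c = 0..<n. if c = k then ?B $$ (j, k) * D $$ (k, k) else 0)"
    using D(1,3) assms by (intro sum.cong) (auto simp: diagonal_mat_def)
  finally have R: "(?B * D) $$ (j, k) = ?B $$ (j, k) * D $$ (k, k)"
    using assms by simp
  have "D $$ (j, j) \<noteq> 0"
    using D(4) assms(3) by force
  moreover have "?A $$ (j, k) = hermitian_entry X j k" "?B $$ (j, k) = hermitian_entry Y j k"
    using assms(2-4) Y by (simp_all add: hermitian_adj_mat_initial_segment)
  ultimately show ?thesis
    using L R DA nz by auto
qed

text \<open>A path has no arcs, so neither has \<open>Z\<close>, and a nonzero entry comes from an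
  edge that \<open>f\<close> maps to a path edge.\<close>

lemma hermitian_entry_iso_path:
  assumes "f ` verts Z = {0..<N}" "edges (path_graph N) = (\<lambda>e. f ` e) ` edges Z"
    and "arcs (path_graph N) = map_prod f f ` arcs Z" and "hermitian_entry Z x y \<noteq> 0"
  shows "f y = Suc (f x) \<or> f x = Suc (f y)"
proof -
  have "arcs Z = {}"
    using assms(3) by (simp add: path_graph_def)
  then have "{x, y} \<in> edges Z"
    using assms(4) by (auto simp: hermitian_entry_def split: if_splits)
  then have "f ` {x, y} \<in> edges (path_graph N)"
    using assms(2) by blast
  then show ?thesis
    by (auto simp: path_graph_def doubleton_eq_iff)
qed

theorem path_not_DHS:
  assumes n: "n \<ge> 3"
  shows "\<not> DHS (path_graph (2 * n - 1))"
proof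
  let ?Y = "path_cycle_graph n" and ?N = "2 * n - 1"
  assume "DHS (path_graph ?N)"
  then obtain Z where Z: "mixed_graph_iso Z (path_graph ?N)" "switching_equivalent ?Y Z"
    using mixed_graph_path_cycle_graph[OF n] path_cycle_cospectral[OF n] by (auto simp: DHS_def)
  have vY: "verts ?Y = {0..<?N}"
    by (simp add: path_cycle_graph_def)
  then have vZ: "verts Z = {0..<?N}"
    using Z(2) by (simp add: switching_equivalent_def)
  obtain f where f: "bij_betw f {0..<?N} {0..<?N}"
    "edges (path_graph ?N) = (\<lambda>e. f ` e) ` edges Z"
    "arcs (path_graph ?N) = map_prod f f ` arcs Z"
    using Z(1) vZ by (auto simp: mixed_graph_iso_def path_graph_def)
  have adj: "f y = Suc (f x) \<or> f x = Suc (f y)"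
    if "x < ?N" "y < ?N" "hermitian_entry ?Y x y \<noteq> 0" for x y
    using hermitian_entry_iso_path[OF _ f(2,3)] f(1) vZ
      switching_equivalent_entry_nonzero[OF Z(2) vY that]
    by (simp add: bij_betw_def)
  \<comment> \<open>A cycle vertex with the largest position on the path has two neighbours, and both would
    have to be its predecessor on the path.\<close>
  let ?C = "{n - 1..<?N}"
  have "Max (f ` ?C) \<in> f ` ?C"
    using n by (intro Max_in) auto
  then obtain x where x: "x \<in> ?C" and "f x = Max (f ` ?C)"
    by force
  then have max: "f y \<le> f x" if "y \<in> ?C" for y
    using that by simp
  \<comment> \<open>These are the cyclic predecessor and successor of \<open>x\<close>, distinct
    because the cycle has at least three vertices.\<close>
  define y z where "y = (if x = n - 1 then 2 * n - 2 else x - 1)"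
    and "z = (if x = 2 * n - 2 then n - 1 else Suc x)"
  have yz: "y \<in> ?C" "z \<in> ?C" "y \<noteq> z"
    using x n by (auto simp: y_def z_def)
  obtain i where i: "x = n - 1 + i" "i < n"
    using x le_Suc_ex[of "n - 1" x] by auto
  obtain m where m: "n = m + 3"
    using n by (metis add.commute le_Suc_ex)
  have "hermitian_entry ?Y x y \<noteq> 0"
    unfolding path_cycle_entry[OF n] y_def using i m by (cases i) auto
  moreover have "hermitian_entry ?Y x z \<noteq> 0"
    unfolding path_cycle_entry[OF n] z_def using i m by (cases "i = m + 2") auto
  ultimately have "f x = Suc (f y)" "f x = Suc (f z)"
    using adj[of x y] adj[of x z] max[OF yz(1)] max[OF yz(2)] x yz by simp_all
  then have "f y = f z" by simp
  then show False
    using f(1) yz by (auto simp: bij_betw_def inj_on_def)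
qed

theorem theorem3p16:
  fixes k :: nat
  assumes "k \<ge> 1"
  shows "\<not> DHS (path_graph (4 * k + 1))"
  \<comment> \<open>Here \<open>4 * k + 1 = 2 * (2 * k + 1) - 1\<close>, and
    \<open>k \<ge> 1\<close> makes the cycle length \<open>2 * k + 1\<close> at least 3.\<close>
  using path_not_DHS[of "2 * k + 1"] assms by simp

end
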